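(* Let $(X,\kappa)$ be a Lefschetz complex, let $\mathcal V$ be a combinatorial multivector field on $X$, and assume that $X$ is invariant with respect to $\mathcal V$. For a subset $A\subseteq X$ the following conditions are equivalent: (i) $A$ is an attractor; (ii) $A$ is invariant and closed; (iii) $A$ is isolated invariant and closed; (iv) $A$ is isolated invariant, closed and a trapping region.
   Context: Fix a ring $R$ with unity. A Lefschetz complex $(X,\kappa)$ is a finite set $X=\bigsqcup_{q\ge 0}X_q$ graded by non-negative integers with a map $\kappa:X\times X\to R$ such that $\kappa(x,y)\ne 0$ implies $x\in X_q$, $y\in X_{q-1}$ for some $q$, and $\sum_{y\in X}\kappa(x,y)\kappa(y,z)=0$ for all $x,z\in X$. Let $\le_\kappa$ be the smallest partial order on $X$ with $y\le_\kappa x$ whenever $\kappa(x,y)\neq 0$. $X$ carries the topology whose open sets are the upper sets of $\le_\kappa$, so $\operatorname{cl}A=\{y\in X: y\le_\kappa x\text{ for some }x\in A\}$; $\operatorname{cl}x=\operatorname{cl}\{x\}$, $\operatorname{mo}A:=\operatorname{cl}A\setminus A$. A set $A$ is proper if $\operatorname{mo}A$ is closed. The Lefschetz homology $H^\kappa(X)$ is the homology of the free chain complex $R(X)$ with basis $X$ and $\partial x=\sum_y\kappa(x,y)y$; a proper subset with the restricted $\kappa$ is again a Lefschetz complex. A multivector is a proper $V\subseteq X$ with a unique maximal element $V^\star$ with respect to $\le_\kappa$; it is regular if $H^\kappa(V)=0$ and critical otherwise. A combinatorial multivector field $\mathcal V$ on $X$ is a partition of $X$ into multivectors; $[x]$ is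 the multivector containing $x$ and $x^\star:=[x]^\star$. Define $\Pi_{\mathcal V}:X\to\mathcal P(X)$ by: $y\in\Pi_{\mathcal V}(x)$ iff (a) $x\ne y=x^\star$, or (b) $x=x^\star$ and $y\in\operatorname{cl}x\setminus[x]$, or (c) $x=x^\star=y$ and $[x]$ is critical. Put $\Pi_{\mathcal V}(N)=\bigcup_{x\in N}\Pi_{\mathcal V}(x)$. A solution is a map $\varphi$ from an interval of $\mathbb Z$ to $X$ with $\varphi(i+1)\in\Pi_{\mathcal V}(\varphi(i))$ whenever $i,i+1$ are in the domain; it is full if its domain is $\mathbb Z$ and a path if its domain is finite. $\operatorname{Sol}(x,A)$ is the set of full solutions with values in $A$ and with $x$ among their values. $A$ is $\mathcal V$-compatible if $x\in A$ implies $[x]\subseteq A$; $[A]_{\mathcal V}^-$ is the largest $\mathcal V$-compatible subset of $A$. $\operatorname{Inv}A:=\{x\in A:\operatorname{Sol}(x^\star,[A]_{\mathcal V}^-)\ne\emptyset\}$; $A$ is invariant if $\operatorname{Inv}A=A$. An isolated invariant set is an invariant set $S$ such that there is no path $\varphi$ whose values at both endpoints of its domain lie in $S$, with $\operatorname{im}\varphi\subseteq\operatorname{cl}S$ and $\operatorname{im}\varphi\cap\operatorname{mo}S\neq\emptyset$. A trapping region is a $\mathcal V$-compatible $N\subseteq X$ with $\Pi_{\mathcal V}(N)\subseteq N$. An attractor is a set of the form $\operatorname{Inv}N$ with $N$ a trapping region. *)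

theory Defs
  imports
    "HOL-Analysis.Abstract_Topology"
    "HOL-Algebra.Coset"
    "HOL-Algebra.Elementary_Groups"
    "HOL-Library.Disjoint_Sets"
begin

text \<open>
  The set \<open>X\<^sub>q\<close> of cells of degree \<open>q\<close> is \<open>{x \<in> cells L. grade L x = q}\<close>. Only the values of
  \<open>grade L\<close> and \<open>kappa L\<close> on \<open>cells L\<close> are meaningful, so the restriction of \<open>L\<close> to a set of cells
  \<open>V\<close> is simply \<open>L\<lparr>cells := V\<rparr>\<close>. The sort \<open>{ring, monoid_mult}\<close> is that of a ring with unity, not
  necessarily commutative, and without the requirement \<open>0 \<noteq> 1\<close> made by \<open>ring_1\<close>.
\<close>

record ('a, 'r) lefschetz =
  cells :: "'a set"
  grade :: "'a \<Rightarrow> nat"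
  kappa :: "'a \<Rightarrow> 'a \<Rightarrow> 'r"

definition lefschetz_complex :: "('a, 'r::{ring,monoid_mult}) lefschetz \<Rightarrow> bool" where
  "lefschetz_complex L \<longleftrightarrow>
     finite (cells L) \<and>
     (\<forall>x\<in>cells L. \<forall>y\<in>cells L. kappa L x y \<noteq> 0 \<longrightarrow> grade L x = grade L y + 1) \<and>
     (\<forall>x\<in>cells L. \<forall>z\<in>cells L. (\<Sum>y\<in>cells L. kappa L x y * kappa L y z) = 0)"

text \<open>A pair \<open>(y, x)\<close> in the face order means \<open>y \<le> x\<close>.\<close>

definition face_order :: "('a, 'r::{ring,monoid_mult}) lefschetz \<Rightarrow> 'a rel" where
  "face_order L =
     (LEAST r. partial_order_on (cells L) r \<and>
        (\<forall>x\<in>cells L. \<forall>y\<in>cells L. kappa L x y \<noteq> 0 \<longrightarrow> (y, x) \<in> r))"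

definition lef_topology :: "('a, 'r::{ring,monoid_mult}) lefschetz \<Rightarrow> 'a topology" where
  "lef_topology L =
     topology (\<lambda>U. U \<subseteq> cells L \<and> (\<forall>x y. x \<in> U \<and> (x, y) \<in> face_order L \<longrightarrow> y \<in> U))"

abbreviation cl :: "('a, 'r::{ring,monoid_mult}) lefschetz \<Rightarrow> 'a set \<Rightarrow> 'a set" where
  "cl L A \<equiv> lef_topology L closure_of A"

definition mo :: "('a, 'r::{ring,monoid_mult}) lefschetz \<Rightarrow> 'a set \<Rightarrow> 'a set" where
  "mo L A = cl L A - A"

abbreviation lef_closed :: "('a, 'r::{ring,monoid_mult}) lefschetz \<Rightarrow> 'a set \<Rightarrow> bool" where
  "lef_closed L A \<equiv> closedin (lef_topology L) A"

definition proper_set :: "('a, 'r::{ring,monoid_mult}) lefschetz \<Rightarrow> 'a set \<Rightarrow> bool" where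
  "proper_set L A \<longleftrightarrow> A \<subseteq> cells L \<and> lef_closed L (mo L A)"

text \<open>
  A chain \<open>c\<close> stands for the element \<open>\<Sum>x. c x \<cdot> x\<close> of the free left module on the cells, so that
  \<open>\<partial> x = \<Sum>y. \<kappa>(x,y) \<cdot> y\<close> extends to \<open>(\<partial> c) y = \<Sum>x. c x * \<kappa>(x,y)\<close>. Only the additive group
  of the homology modules is recorded, which is all that is needed to say that they vanish.
\<close>

definition chain_group :: "('a, 'r::{ring,monoid_mult}) lefschetz \<Rightarrow> nat \<Rightarrow> ('a \<Rightarrow> 'r) monoid" where
  "chain_group L q =
     \<lparr>carrier = {c. \<forall>x. c x \<noteq> 0 \<longrightarrow> x \<in> cells L \<and> grade L x = q},
      mult = (\<lambda>c d x. c x + d x),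
      one = (\<lambda>x. 0)\<rparr>"

definition boundary :: "('a, 'r::{ring,monoid_mult}) lefschetz \<Rightarrow> ('a \<Rightarrow> 'r) \<Rightarrow> 'a \<Rightarrow> 'r" where
  "boundary L c = (\<lambda>y. if y \<in> cells L then \<Sum>x\<in>cells L. c x * kappa L x y else 0)"

definition cycles :: "('a, 'r::{ring,monoid_mult}) lefschetz \<Rightarrow> nat \<Rightarrow> ('a \<Rightarrow> 'r) set" where
  "cycles L q = {c \<in> carrier (chain_group L q). boundary L c = (\<lambda>x. 0)}"

definition boundaries :: "('a, 'r::{ring,monoid_mult}) lefschetz \<Rightarrow> nat \<Rightarrow> ('a \<Rightarrow> 'r) set" where
  "boundaries L q = boundary L ` carrier (chain_group L (q + 1))"

definition homology :: "('a, 'r::{ring,monoid_mult}) lefschetz \<Rightarrow> nat \<Rightarrow> ('a \<Rightarrow> 'r) set monoid" where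
  "homology L q = (chain_group L q)\<lparr>carrier := cycles L q\<rparr> Mod boundaries L q"

definition zero_homology :: "('a, 'r::{ring,monoid_mult}) lefschetz \<Rightarrow> bool" where
  "zero_homology L \<longleftrightarrow> (\<forall>q. trivial_group (homology L q))"

definition maximal_in :: "('a, 'r::{ring,monoid_mult}) lefschetz \<Rightarrow> 'a set \<Rightarrow> 'a \<Rightarrow> bool" where
  "maximal_in L V v \<longleftrightarrow> v \<in> V \<and> (\<forall>w\<in>V. (v, w) \<in> face_order L \<longrightarrow> w = v)"

definition multivector :: "('a, 'r::{ring,monoid_mult}) lefschetz \<Rightarrow> 'a set \<Rightarrow> bool" where
  "multivector L V \<longleftrightarrow> proper_set L V \<and> (\<exists>!v. maximal_in L V v)"

definition mv_max :: "('a, 'r::{ring,monoid_mult}) lefschetz \<Rightarrow> 'a set \<Rightarrow> 'a" where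
  "mv_max L V = (THE v. maximal_in L V v)"

definition regular :: "('a, 'r::{ring,monoid_mult}) lefschetz \<Rightarrow> 'a set \<Rightarrow> bool" where
  "regular L V \<longleftrightarrow> zero_homology (L\<lparr>cells := V\<rparr>)"

abbreviation critical :: "('a, 'r::{ring,monoid_mult}) lefschetz \<Rightarrow> 'a set \<Rightarrow> bool" where
  "critical L V \<equiv> \<not> regular L V"

definition multivector_field :: "('a, 'r::{ring,monoid_mult}) lefschetz \<Rightarrow> 'a set set \<Rightarrow> bool" where
  "multivector_field L \<V> \<longleftrightarrow> partition_on (cells L) \<V> \<and> (\<forall>V\<in>\<V>. multivector L V)"

definition mv_of :: "'a set set \<Rightarrow> 'a \<Rightarrow> 'a set" where
  "mv_of \<V> x = (THE V. V \<in> \<V> \<and> x \<in> V)"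

definition star :: "('a, 'r::{ring,monoid_mult}) lefschetz \<Rightarrow> 'a set set \<Rightarrow> 'a \<Rightarrow> 'a" where
  "star L \<V> x = mv_max L (mv_of \<V> x)"

definition Pi_mv :: "('a, 'r::{ring,monoid_mult}) lefschetz \<Rightarrow> 'a set set \<Rightarrow> 'a \<Rightarrow> 'a set" where
  "Pi_mv L \<V> x =
     {y \<in> cells L.
        (x \<noteq> y \<and> y = star L \<V> x) \<or>
        (x = star L \<V> x \<and> y \<in> cl L {x} - mv_of \<V> x) \<or>
        (x = star L \<V> x \<and> star L \<V> x = y \<and> critical L (mv_of \<V> x))}"

definition int_interval :: "int set \<Rightarrow> bool" where
  "int_interval I \<longleftrightarrow> (\<forall>i\<in>I. \<forall>k\<in>I. {i..k} \<subseteq> I)"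

text \<open>A solution with domain \<open>I\<close> is a function on \<open>int\<close> whose values outside \<open>I\<close> are irrelevant.\<close>

definition solution ::
  "('a, 'r::{ring,monoid_mult}) lefschetz \<Rightarrow> 'a set set \<Rightarrow> int set \<Rightarrow> (int \<Rightarrow> 'a) \<Rightarrow> bool" where
  "solution L \<V> I \<phi> \<longleftrightarrow>
     int_interval I \<and> \<phi> ` I \<subseteq> cells L \<and>
     (\<forall>i. i \<in> I \<and> i + 1 \<in> I \<longrightarrow> \<phi> (i + 1) \<in> Pi_mv L \<V> (\<phi> i))"

definition full_solution ::
  "('a, 'r::{ring,monoid_mult}) lefschetz \<Rightarrow> 'a set set \<Rightarrow> (int \<Rightarrow> 'a) \<Rightarrow> bool" where
  "full_solution L \<V> \<phi> \<longleftrightarrow> solution L \<V> UNIV \<phi>"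

definition path_solution ::
  "('a, 'r::{ring,monoid_mult}) lefschetz \<Rightarrow> 'a set set \<Rightarrow> int set \<Rightarrow> (int \<Rightarrow> 'a) \<Rightarrow> bool" where
  "path_solution L \<V> I \<phi> \<longleftrightarrow> solution L \<V> I \<phi> \<and> finite I \<and> I \<noteq> {}"

definition Sol ::
  "('a, 'r::{ring,monoid_mult}) lefschetz \<Rightarrow> 'a set set \<Rightarrow> 'a \<Rightarrow> 'a set \<Rightarrow> (int \<Rightarrow> 'a) set" where
  "Sol L \<V> x A = {\<phi>. full_solution L \<V> \<phi> \<and> range \<phi> \<subseteq> A \<and> x \<in> range \<phi>}"

definition compatible :: "'a set set \<Rightarrow> 'a set \<Rightarrow> bool" where
  "compatible \<V> A \<longleftrightarrow> (\<forall>x\<in>A. mv_of \<V> x \<subseteq> A)"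

definition compatible_core :: "'a set set \<Rightarrow> 'a set \<Rightarrow> 'a set" where
  "compatible_core \<V> A = (GREATEST B. B \<subseteq> A \<and> compatible \<V> B)"

definition Inv :: "('a, 'r::{ring,monoid_mult}) lefschetz \<Rightarrow> 'a set set \<Rightarrow> 'a set \<Rightarrow> 'a set" where
  "Inv L \<V> A = {x \<in> A. Sol L \<V> (star L \<V> x) (compatible_core \<V> A) \<noteq> {}}"

definition invariant :: "('a, 'r::{ring,monoid_mult}) lefschetz \<Rightarrow> 'a set set \<Rightarrow> 'a set \<Rightarrow> bool" where
  "invariant L \<V> A \<longleftrightarrow> A \<subseteq> cells L \<and> Inv L \<V> A = A"

definition isolated_invariant ::
  "('a, 'r::{ring,monoid_mult}) lefschetz \<Rightarrow> 'a set set \<Rightarrow> 'a set \<Rightarrow> bool" where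
  "isolated_invariant L \<V> S \<longleftrightarrow>
     invariant L \<V> S \<and>
     \<not> (\<exists>I \<phi>. path_solution L \<V> I \<phi> \<and> \<phi> (Min I) \<in> S \<and> \<phi> (Max I) \<in> S \<and>
            \<phi> ` I \<subseteq> cl L S \<and> \<phi> ` I \<inter> mo L S \<noteq> {})"

definition trapping_region ::
  "('a, 'r::{ring,monoid_mult}) lefschetz \<Rightarrow> 'a set set \<Rightarrow> 'a set \<Rightarrow> bool" where
  "trapping_region L \<V> N \<longleftrightarrow>
     N \<subseteq> cells L \<and> compatible \<V> N \<and> (\<Union>x\<in>N. Pi_mv L \<V> x) \<subseteq> N"

definition attractor ::
  "('a, 'r::{ring,monoid_mult}) lefschetz \<Rightarrow> 'a set set \<Rightarrow> 'a set \<Rightarrow> bool" where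
  "attractor L \<V> A \<longleftrightarrow> (\<exists>N. trapping_region L \<V> N \<and> A = Inv L \<V> N)"

text \<open>The descriptions \<open>LEAST\<close>, \<open>GREATEST\<close>, \<open>topology\<close> and \<open>THE\<close> above denote as intended.\<close>

lemma face_order_least:
  assumes "lefschetz_complex L"
  defines "P \<equiv> \<lambda>r. partial_order_on (cells L) r \<and>
        (\<forall>x\<in>cells L. \<forall>y\<in>cells L. kappa L x y \<noteq> 0 \<longrightarrow> (y, x) \<in> r)"
  shows "P (face_order L)" and "\<And>r. P r \<Longrightarrow> face_order L \<subseteq> r"
proof -
  define r0 where "r0 = {(y, x). y \<in> cells L \<and> x \<in> cells L \<and> (y = x \<or> grade L y < grade L x)}"
  have r0: "P r0"
    using assms(1)
    by (auto simp: P_def r0_def lefschetz_complex_def order_on_defs refl_on_def trans_def antisym_def)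
  define m where "m = \<Inter>{r. P r}"
  have m_le: "m \<subseteq> r" if "P r" for r
    using that by (auto simp: m_def)
  have "m \<subseteq> cells L \<times> cells L"
    using m_le[OF r0] by (auto simp: r0_def)
  moreover have "refl_on (cells L) m"
    by (auto simp: m_def P_def order_on_defs refl_on_def)
  moreover have "trans m"
    unfolding trans_def m_def P_def order_on_defs by blast
  moreover have "antisym m"
    using m_le[OF r0] r0 unfolding P_def order_on_defs antisym_def by blast
  ultimately have "P m"
    by (auto simp: P_def order_on_defs) (auto simp: m_def P_def)
  moreover have "face_order L = m"
    unfolding face_order_def
    by (rule Least_equality) (use \<open>P m\<close> m_le in \<open>auto simp: P_def\<close>)
  ultimately show "P (face_order L)" and "\<And>r. P r \<Longrightarrow> face_order L \<subseteq> r"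
    using m_le by auto
qed

lemma openin_lef_topology:
  "openin (lef_topology L) U \<longleftrightarrow>
     U \<subseteq> cells L \<and> (\<forall>x y. x \<in> U \<and> (x, y) \<in> face_order L \<longrightarrow> y \<in> U)"
proof -
  have "istopology (\<lambda>U. U \<subseteq> cells L \<and> (\<forall>x y. x \<in> U \<and> (x, y) \<in> face_order L \<longrightarrow> y \<in> U))"
    unfolding istopology_def by blast
  then show ?thesis
    by (simp add: lef_topology_def topology_inverse')
qed

lemma topspace_lef_topology:
  assumes "lefschetz_complex L"
  shows "topspace (lef_topology L) = cells L"
proof -
  have "openin (lef_topology L) (cells L)"
    using face_order_least(1)[OF assms]
    by (auto simp: openin_lef_topology partial_order_on_def preorder_on_def)
  then show ?thesis
    by (meson openin_lef_topology openin_subset openin_topspace subset_antisym)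
qed

lemma cl_eq:
  assumes "lefschetz_complex L" and "A \<subseteq> cells L"
  shows "cl L A = {y \<in> cells L. \<exists>x\<in>A. (y, x) \<in> face_order L}"
proof -
  have po: "face_order L \<subseteq> cells L \<times> cells L" "refl_on (cells L) (face_order L)"
    "trans (face_order L)"
    using face_order_least(1)[OF assms(1)] by (auto simp: order_on_defs)
  have "y \<in> cl L A \<longleftrightarrow> (\<exists>x\<in>A. (y, x) \<in> face_order L)" if y: "y \<in> cells L" for y
  proof
    assume ycl: "y \<in> cl L A"
    have "openin (lef_topology L) {x. (y, x) \<in> face_order L}"
      unfolding openin_lef_topology using po(1) transD[OF po(3)] by blast
    moreover have "y \<in> {x. (y, x) \<in> face_order L}"
      using po(2) y by (simp add: refl_on_def)
    ultimately obtain x where "x \<in> A" "x \<in> {x. (y, x) \<in> face_order L}"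
      using ycl unfolding in_closure_of by meson
    then show "\<exists>x\<in>A. (y, x) \<in> face_order L" by blast
  next
    assume "\<exists>x\<in>A. (y, x) \<in> face_order L"
    then obtain x where x: "x \<in> A" "(y, x) \<in> face_order L" by blast
    have "y \<in> topspace (lef_topology L)"
      using y by (simp add: topspace_lef_topology[OF assms(1)])
    moreover have "x \<in> U" if "openin (lef_topology L) U" "y \<in> U" for U
      using that x(2) unfolding openin_lef_topology by blast
    ultimately show "y \<in> cl L A"
      unfolding in_closure_of using x(1) by blast
  qed
  moreover have "cl L A \<subseteq> cells L"
    using closure_of_subset_topspace[of "lef_topology L" A]
    by (simp only: topspace_lef_topology[OF assms(1)])
  ultimately show ?thesis by blast
qed

lemma compatible_core:
  "compatible_core \<V> A \<subseteq> A" "compatible \<V> (compatible_core \<V> A)"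
  "B \<subseteq> A \<Longrightarrow> compatible \<V> B \<Longrightarrow> B \<subseteq> compatible_core \<V> A"
proof -
  define M where "M = \<Union>{B. B \<subseteq> A \<and> compatible \<V> B}"
  have M: "M \<subseteq> A" "\<And>B. B \<subseteq> A \<Longrightarrow> compatible \<V> B \<Longrightarrow> B \<subseteq> M"
    by (auto simp: M_def)
  moreover have "compatible \<V> M"
    unfolding M_def compatible_def by blast
  moreover have "compatible_core \<V> A = M"
    unfolding compatible_core_def by (rule Greatest_equality) (use calculation in auto)
  ultimately show "compatible_core \<V> A \<subseteq> A" "compatible \<V> (compatible_core \<V> A)"
    "B \<subseteq> A \<Longrightarrow> compatible \<V> B \<Longrightarrow> B \<subseteq> compatible_core \<V> A"
    by auto
qed

lemma mv_of:
  assumes "multivector_field L \<V>" and "x \<in> cells L"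
  shows "mv_of \<V> x \<in> \<V>" and "x \<in> mv_of \<V> x"
proof -
  have "\<exists>!V. V \<in> \<V> \<and> x \<in> V"
    using assms by (auto simp: multivector_field_def partition_on_def disjoint_def)
  then have "mv_of \<V> x \<in> \<V> \<and> x \<in> mv_of \<V> x"
    unfolding mv_of_def by (rule theI')
  then show "mv_of \<V> x \<in> \<V>" and "x \<in> mv_of \<V> x" by auto
qed

lemma mv_max:
  assumes "multivector L V"
  shows "maximal_in L V (mv_max L V)"
  unfolding mv_max_def by (rule theI') (use assms in \<open>simp add: multivector_def\<close>)

lemma lefschetz_complex_restrict:
  assumes L: "lefschetz_complex L" and V: "proper_set L V"
  shows "lefschetz_complex (L\<lparr>cells := V\<rparr>)"
proof -
  have VX: "V \<subseteq> cells L" and mo: "lef_closed L (mo L V)"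
    using V by (auto simp: proper_set_def)
  have fin: "finite (cells L)"
    using L by (simp add: lefschetz_complex_def)
  have face: "(y, x) \<in> face_order L" if "x \<in> cells L" "y \<in> cells L" "kappa L x y \<noteq> 0" for x y
    using face_order_least(1)[OF L] that by blast
  have "(\<Sum>y\<in>V. kappa L x y * kappa L y z) = 0" if xz: "x \<in> V" "z \<in> V" for x z
  proof -
    have "kappa L x y * kappa L y z = 0" if y: "y \<in> cells L - V" for y
    proof (rule ccontr)
      assume "kappa L x y * kappa L y z \<noteq> 0"
      then have "kappa L x y \<noteq> 0" "kappa L y z \<noteq> 0" by auto
      then have yx: "(y, x) \<in> face_order L" and zy: "(z, y) \<in> face_order L"
        using face xz y VX by auto
      from yx have "y \<in> mo L V"
        using xz y by (auto simp: mo_def cl_eq[OF L VX])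
      then have "z \<in> cl L (mo L V)"
        using zy xz VX closedin_subset[OF mo]
        by (subst cl_eq[OF L]) (auto simp: topspace_lef_topology[OF L])
      then have "z \<in> mo L V"
        using mo closure_of_closedin by blast
      with xz show False by (simp add: mo_def)
    qed
    then have "(\<Sum>y\<in>V. kappa L x y * kappa L y z) = (\<Sum>y\<in>cells L. kappa L x y * kappa L y z)"
      using fin VX by (intro sum.mono_neutral_left) auto
    also have "\<dots> = 0"
      using L subsetD[OF VX xz(1)] subsetD[OF VX xz(2)] unfolding lefschetz_complex_def by blast
    finally show ?thesis .
  qed
  moreover have "finite V"
    using VX fin by (rule finite_subset)
  moreover have "grade L x = grade L y + 1" if "x \<in> V" "y \<in> V" "kappa L x y \<noteq> 0" for x y
    using L that VX unfolding lefschetz_complex_def by blast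
  ultimately show ?thesis
    by (simp add: lefschetz_complex_def)
qed

lemma comm_group_chain_group: "comm_group (chain_group L q)"
proof (rule comm_groupI)
  fix c assume c: "c \<in> carrier (chain_group L q)"
  show "\<exists>d\<in>carrier (chain_group L q). d \<otimes>\<^bsub>chain_group L q\<^esub> c = \<one>\<^bsub>chain_group L q\<^esub>"
    by (rule bexI[of _ "\<lambda>x. - c x"]) (use c in \<open>auto simp: chain_group_def\<close>)
qed (auto simp: chain_group_def add_ac, (metis add_0)+)

lemma group_homology:
  assumes L: "lefschetz_complex L"
  shows "group (homology L q)"
proof -
  interpret C: comm_group "chain_group L p" for p
    by (rule comm_group_chain_group)
  have zero: "boundary L (\<lambda>x. 0) = (\<lambda>x. 0)"
    by (auto simp: boundary_def)
  have add: "boundary L (\<lambda>x. c x + d x) = (\<lambda>x. boundary L c x + boundary L d x)" for c d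
    by (auto simp: boundary_def sum.distrib distrib_right)
  have neg: "boundary L (\<lambda>x. - c x) = (\<lambda>x. - boundary L c x)" for c
    by (auto simp: boundary_def sum_negf)
  have inv: "inv\<^bsub>chain_group L p\<^esub> c = (\<lambda>x. - c x)" if "c \<in> carrier (chain_group L p)" for c p
    by (rule C.inv_equality) (use that in \<open>auto simp: chain_group_def\<close>)
  have dd: "boundary L (boundary L c) = (\<lambda>x. 0)" for c
  proof
    fix z
    show "boundary L (boundary L c) z = 0"
    proof (cases "z \<in> cells L")
      case True
      have "boundary L (boundary L c) z =
          (\<Sum>y\<in>cells L. \<Sum>x\<in>cells L. c x * (kappa L x y * kappa L y z))"
        using True by (simp add: boundary_def sum_distrib_right mult.assoc)
      also have "\<dots> = (\<Sum>x\<in>cells L. c x * (\<Sum>y\<in>cells L. kappa L x y * kappa L y z))"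
        by (subst sum.swap) (simp add: sum_distrib_left)
      also have "\<dots> = 0"
        using L True by (simp add: lefschetz_complex_def)
      finally show ?thesis .
    qed (simp add: boundary_def)
  qed
  have deg: "boundary L c \<in> carrier (chain_group L q)" if "c \<in> carrier (chain_group L (q + 1))" for c
  proof -
    have "grade L y = q" if "y \<in> cells L" "(\<Sum>x\<in>cells L. c x * kappa L x y) \<noteq> 0" for y
    proof -
      obtain x where "x \<in> cells L" "c x * kappa L x y \<noteq> 0"
        using \<open>(\<Sum>x\<in>cells L. c x * kappa L x y) \<noteq> 0\<close> by (meson sum.neutral)
      moreover from this have "c x \<noteq> 0" "kappa L x y \<noteq> 0" by auto
      ultimately show ?thesis
        using L \<open>c \<in> _\<close> \<open>y \<in> cells L\<close> by (fastforce simp: lefschetz_complex_def chain_group_def)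
    qed
    then show ?thesis
      by (auto simp: chain_group_def boundary_def split: if_splits)
  qed
  have Z: "subgroup (cycles L q) (chain_group L q)"
  proof (rule C.subgroupI)
    show "cycles L q \<noteq> {}"
      using zero by (auto simp: cycles_def chain_group_def)
  next
    fix c d assume "c \<in> cycles L q" "d \<in> cycles L q"
    then show "c \<otimes>\<^bsub>chain_group L q\<^esub> d \<in> cycles L q"
      using C.m_closed[of c q d] by (auto simp: cycles_def) (simp add: chain_group_def add)
  next
    fix c assume "c \<in> cycles L q"
    then show "inv\<^bsub>chain_group L q\<^esub> c \<in> cycles L q"
      using C.inv_closed[of c q] by (auto simp: cycles_def inv neg)
  qed (auto simp: cycles_def)
  have B: "subgroup (boundaries L q) (chain_group L q)"
  proof (rule C.subgroupI)
    show "boundaries L q \<subseteq> carrier (chain_group L q)"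
      using deg by (auto simp: boundaries_def)
    show "boundaries L q \<noteq> {}"
      using C.one_closed by (auto simp: boundaries_def)
  next
    fix c d assume "c \<in> boundaries L q" "d \<in> boundaries L q"
    then obtain c' d' where "c = boundary L c'" "d = boundary L d'"
      "c' \<in> carrier (chain_group L (q + 1))" "d' \<in> carrier (chain_group L (q + 1))"
      by (auto simp: boundaries_def)
    moreover from this have "(\<lambda>x. c' x + d' x) \<in> carrier (chain_group L (q + 1))"
      using C.m_closed[of c' "q + 1" d'] by (simp add: chain_group_def)
    moreover have "c \<otimes>\<^bsub>chain_group L q\<^esub> d = boundary L (\<lambda>x. c' x + d' x)"
      using calculation(1,2) by (simp add: chain_group_def add)
    ultimately show "c \<otimes>\<^bsub>chain_group L q\<^esub> d \<in> boundaries L q"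
      unfolding boundaries_def by blast
  next
    fix c assume c: "c \<in> boundaries L q"
    then obtain c' where c': "c = boundary L c'" "c' \<in> carrier (chain_group L (q + 1))"
      by (auto simp: boundaries_def)
    then have "(\<lambda>x. - c' x) \<in> carrier (chain_group L (q + 1))"
      by (simp add: chain_group_def)
    moreover have "inv\<^bsub>chain_group L q\<^esub> c = boundary L (\<lambda>x. - c' x)"
      using inv[of c q] deg c' by (simp add: neg)
    ultimately show "inv\<^bsub>chain_group L q\<^esub> c \<in> boundaries L q"
      unfolding boundaries_def by blast
  qed
  have BZ: "boundaries L q \<subseteq> cycles L q"
    using deg dd by (auto simp: boundaries_def cycles_def)
  have "boundaries L q \<lhd> (chain_group L q)\<lparr>carrier := cycles L q\<rparr>"
    by (rule C.normal_restrict_supergroup[OF Z C.subgroup_imp_normal[OF B] BZ])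
  then show ?thesis
    unfolding homology_def by (rule normal.factorgroup_is_group)
qed

end

theory Submission
  imports Defs
begin

text \<open>
  A closed invariant set is compatible and contains every image of its points, so it is a trapping
  region, and its mouth is empty, so it is isolated. Conversely, let \<open>N\<close> be a trapping region.
  Being compatible, \<open>N\<close> is closed, because \<open>\<Pi>(x\<^sup>\<star>)\<close> contains \<open>cl x\<^sup>\<star> - [x]\<close>. If \<open>x\<close> lies in
  \<open>Inv N\<close> and \<open>y \<notin> [x]\<close> is a face of \<open>x\<close>, then a solution through \<open>x\<^sup>\<star>\<close> in \<open>N\<close>, cut off at \<open>x\<^sup>\<star>\<close>,
  continues through \<open>y\<close> to \<open>y\<^sup>\<star>\<close> and then along a solution through \<open>y\<^sup>\<star>\<close>, which exists since \<open>X\<close>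
  is invariant and stays in \<open>N\<close> since \<open>N\<close> is trapping. Hence \<open>Inv N\<close> is closed.
\<close>

locale mv_field =
  fixes L :: "('a, 'r::{ring,monoid_mult}) lefschetz"
    and \<V> :: "'a set set"
  assumes lef: "lefschetz_complex L"
    and mvf: "multivector_field L \<V>"
begin

section \<open>Face order and closed sets\<close>

lemma face_order_cells: "(y, x) \<in> face_order L \<Longrightarrow> x \<in> cells L \<and> y \<in> cells L"
  using face_order_least(1)[OF lef] by (auto simp: order_on_defs)

lemma face_order_refl: "x \<in> cells L \<Longrightarrow> (x, x) \<in> face_order L"
  using face_order_least(1)[OF lef] by (auto simp: order_on_defs refl_on_def)

lemma face_order_trans:
  "(z, y) \<in> face_order L \<Longrightarrow> (y, x) \<in> face_order L \<Longrightarrow> (z, x) \<in> face_order L"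
  using face_order_least(1)[OF lef] unfolding order_on_defs by (meson transD)

lemma lef_closed_iff:
  assumes "A \<subseteq> cells L"
  shows "lef_closed L A \<longleftrightarrow> (\<forall>x\<in>A. \<forall>y. (y, x) \<in> face_order L \<longrightarrow> y \<in> A)"
  using assms face_order_cells
  unfolding closedin_def openin_lef_topology topspace_lef_topology[OF lef] by blast

section \<open>Multivectors, their maximal elements and one-step moves\<close>

lemma mv_of_eq:
  assumes "x \<in> cells L" and "y \<in> mv_of \<V> x"
  shows "mv_of \<V> y = mv_of \<V> x"
proof -
  have V: "mv_of \<V> x \<in> \<V>"
    using mv_of[OF mvf] assms by blast
  moreover have "y \<in> cells L"
    using V assms(2) mvf unfolding multivector_field_def partition_on_def by blast
  ultimately show ?thesis
    using mv_of[OF mvf \<open>y \<in> cells L\<close>] assms mvf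
    unfolding multivector_field_def partition_on_def disjoint_def by blast
qed

lemma mv_of_multivector: "x \<in> cells L \<Longrightarrow> multivector L (mv_of \<V> x)"
  using mv_of[OF mvf] mvf by (auto simp: multivector_field_def)

lemma mv_of_subset: "x \<in> cells L \<Longrightarrow> mv_of \<V> x \<subseteq> cells L"
  using mv_of_multivector by (auto simp: multivector_def proper_set_def)

lemma star_in_mv_of: "x \<in> cells L \<Longrightarrow> star L \<V> x \<in> mv_of \<V> x"
  using mv_max[OF mv_of_multivector] by (auto simp: star_def maximal_in_def)

lemma star_in_cells: "x \<in> cells L \<Longrightarrow> star L \<V> x \<in> cells L"
  using star_in_mv_of mv_of_subset by blast

lemma star_eq:
  "x \<in> cells L \<Longrightarrow> y \<in> mv_of \<V> x \<Longrightarrow> star L \<V> y = star L \<V> x"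
  unfolding star_def by (simp only: mv_of_eq[of x y])

text \<open>In a finite poset every element of \<open>V\<close> lies below some maximal element of
  \<open>V\<close>, and a multivector has only one.\<close>

lemma multivector_le_mv_max:
  assumes "multivector L V" and "x \<in> V"
  shows "(x, mv_max L V) \<in> face_order L"
proof -
  have VX: "V \<subseteq> cells L"
    using assms(1) by (auto simp: multivector_def proper_set_def)
  have "face_order L \<subseteq> cells L \<times> cells L"
    using face_order_cells by (intro subrelI) blast
  then have "finite (face_order L)"
    using lef by (auto simp: lefschetz_complex_def intro: finite_subset)
  then have wf: "wf ((face_order L - Id)\<inverse>)"
    using face_order_least(1)[OF lef]
    by (intro finite_acyclic_wf_converse) (auto intro: partial_order_on_acyclic)
  \<comment> \<open>A minimal element for the converse strict order has nothing of \<open>V\<close>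
    above \<open>x\<close> strictly above it. By transitivity it is then maximal in all of
    \<open>V\<close>.\<close>
  obtain v where v: "v \<in> {w \<in> V. (x, w) \<in> face_order L}"
    and max: "\<And>w. (w, v) \<in> (face_order L - Id)\<inverse> \<Longrightarrow> w \<notin> {w \<in> V. (x, w) \<in> face_order L}"
    using wfE_min[OF wf, of x "{w \<in> V. (x, w) \<in> face_order L}"] assms(2) face_order_refl VX
    by blast
  have "maximal_in L V v"
    using v max face_order_trans unfolding maximal_in_def by blast
  then have "v = mv_max L V"
    using mv_max[OF assms(1)] assms(1) unfolding multivector_def by blast
  with v show ?thesis by simp
qed

lemma le_star: "x \<in> cells L \<Longrightarrow> (x, star L \<V> x) \<in> face_order L"
  unfolding star_def by (rule multivector_le_mv_max[OF mv_of_multivector mv_of(2)[OF mvf]])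

text \<open>Clause (b) speaks only of faces of the maximal element. It applies because
  \<open>x\<close> lies below its star and both have the same multivector.\<close>

lemma Pi_mv_star:
  assumes "x \<in> cells L" and "(y, x) \<in> face_order L" and "y \<notin> mv_of \<V> x"
  shows "y \<in> Pi_mv L \<V> (star L \<V> x)"
proof -
  have "star L \<V> (star L \<V> x) = star L \<V> x" "mv_of \<V> (star L \<V> x) = mv_of \<V> x"
    using assms(1) star_in_mv_of star_eq mv_of_eq by blast+
  moreover have "(y, star L \<V> x) \<in> face_order L"
    using face_order_trans[OF assms(2) le_star[OF assms(1)]] .
  moreover have "y \<in> cells L"
    using face_order_cells[OF assms(2)] by simp
  ultimately show ?thesis
    using assms(3) star_in_cells[OF assms(1)] by (simp add: Pi_mv_def cl_eq[OF lef])
qed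

text \<open>Clauses (b) and (c) require \<open>x\<close> to be its own star, so here the next step
  is forced by (a).\<close>

lemma Pi_mv_eq_star:
  "x \<in> cells L \<Longrightarrow> x \<noteq> star L \<V> x \<Longrightarrow> Pi_mv L \<V> x = {star L \<V> x}"
  using star_in_cells[of x] unfolding Pi_mv_def by blast

section \<open>Closed invariant sets and trapping regions\<close>

lemma compatible_core_eq: "compatible \<V> A \<Longrightarrow> compatible_core \<V> A = A"
  by (intro subset_antisym compatible_core(1) compatible_core(3) subset_refl)

lemma invariant_compatible:
  assumes "invariant L \<V> A"
  shows "compatible \<V> A"
proof -
  have "mv_of \<V> x \<subseteq> A" if "x \<in> A" for x
  proof -
    have x: "x \<in> cells L" and "x \<in> Inv L \<V> A"
      using assms that by (auto simp: invariant_def)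
    \<comment> \<open>The solution witnessing \<open>x \<in> Inv L \<V> A\<close> passes through the
      star and stays in the core.\<close>
    then have "star L \<V> x \<in> compatible_core \<V> A"
      by (auto simp: Inv_def Sol_def)
    then have "mv_of \<V> (star L \<V> x) \<subseteq> A"
      using compatible_core(1,2)[of \<V> A] unfolding compatible_def by blast
    then show ?thesis
      using mv_of_eq[OF x star_in_mv_of[OF x]] by simp
  qed
  then show ?thesis by (simp add: compatible_def)
qed

text \<open>Clauses (a) and (c) lead to the star, which compatibility keeps in \<open>A\<close>;
  clause (b) leads to a face, kept in \<open>A\<close> by closedness.\<close>

lemma invariant_closed_imp_trapping:
  assumes "invariant L \<V> A" and "lef_closed L A"
  shows "trapping_region L \<V> A"
proof -
  have A: "A \<subseteq> cells L" "compatible \<V> A"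
    using assms(1) invariant_compatible by (auto simp: invariant_def)
  have "Pi_mv L \<V> x \<subseteq> A" if "x \<in> A" for x
  proof -
    have "x \<in> cells L" "star L \<V> x \<in> A"
      using A that star_in_mv_of by (auto simp: compatible_def)
    then show ?thesis
      using that assms(2) A(1) by (auto simp: Pi_mv_def cl_eq[OF lef] lef_closed_iff)
  qed
  then show ?thesis
    using A by (auto simp: trapping_region_def)
qed

lemma closed_invariant_isolated:
  assumes "invariant L \<V> A" and "lef_closed L A"
  shows "isolated_invariant L \<V> A"
  using assms by (simp add: isolated_invariant_def mo_def closure_of_closedin)

lemma trapping_region_closed:
  assumes "trapping_region L \<V> N"
  shows "lef_closed L N"
proof -
  have N: "N \<subseteq> cells L" "compatible \<V> N" "\<And>x. x \<in> N \<Longrightarrow> Pi_mv L \<V> x \<subseteq> N"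
    using assms by (auto simp: trapping_region_def)
  have "y \<in> N" if "x \<in> N" "(y, x) \<in> face_order L" for x y
    using that N Pi_mv_star star_in_mv_of unfolding compatible_def by blast
  then show ?thesis
    using N by (simp add: lef_closed_iff)
qed

section \<open>Gluing solutions\<close>

lemma full_solution_iff:
  "full_solution L \<V> \<phi> \<longleftrightarrow> range \<phi> \<subseteq> cells L \<and> (\<forall>i. \<phi> (i + 1) \<in> Pi_mv L \<V> (\<phi> i))"
  by (simp add: full_solution_def solution_def int_interval_def)

text \<open>Follow \<open>\<phi>\<close> up to time \<open>a\<close>, then \<open>\<rho>\<close>
  from time \<open>b\<close> on. Only the past must be known to lie in \<open>N\<close>: trapping
  carries the future, so the values of \<open>\<rho>\<close> before \<open>b\<close> may leave
  \<open>N\<close>.\<close>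

lemma Sol_glue:
  assumes N: "trapping_region L \<V> N"
    and past: "\<And>i::int. i \<le> a \<Longrightarrow> \<phi> i \<in> N"
      "\<And>i. i < a \<Longrightarrow> \<phi> (i + 1) \<in> Pi_mv L \<V> (\<phi> i)"
    and \<rho>: "full_solution L \<V> \<rho>" "\<rho> b \<in> Pi_mv L \<V> (\<phi> a)"
  shows "Sol L \<V> (\<rho> b) N \<noteq> {}"
proof -
  \<comment> \<open>The shift makes \<open>\<psi> (a + 1) = \<rho> b\<close>, so the seam is the
    step from \<open>a\<close> to \<open>a + 1\<close>.\<close>
  define \<psi> where "\<psi> i = (if i \<le> a then \<phi> i else \<rho> (b + (i - a - 1)))" for i
  have step: "\<psi> (i + 1) \<in> Pi_mv L \<V> (\<psi> i)" for i
  proof -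
    consider "i < a" | "i = a" | "i > a" by linarith
    then show ?thesis
    proof cases
      case 3
      have "\<rho> (b + (i - a - 1) + 1) \<in> Pi_mv L \<V> (\<rho> (b + (i - a - 1)))"
        using \<rho>(1) unfolding full_solution_iff by blast
      moreover have "b + (i + 1 - a - 1) = b + (i - a - 1) + 1"
        by simp
      ultimately show ?thesis using 3 unfolding \<psi>_def by simp
    qed (use past \<rho> in \<open>auto simp: \<psi>_def\<close>)
  qed
  have "\<psi> i \<in> N" for i
  proof (cases "i \<le> a")
    case False
    then have "a \<le> i" by simp
    then show ?thesis
    proof (induction i rule: int_ge_induct)
      case base
      then show ?case using past by (simp add: \<psi>_def)
    next
      case (step i)
      then show ?case
        using \<open>\<And>i. \<psi> (i + 1) \<in> Pi_mv L \<V> (\<psi> i)\<close> N unfolding trapping_region_def by blast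
    qed
  qed (use past in \<open>simp add: \<psi>_def\<close>)
  moreover have "\<psi> (a + 1) = \<rho> b"
    by (simp add: \<psi>_def)
  ultimately have "\<psi> \<in> Sol L \<V> (\<rho> b) N"
    using step N by (auto simp: Sol_def full_solution_iff trapping_region_def) (metis rangeI)
  then show ?thesis by blast
qed

section \<open>Invariant part of a trapping region\<close>

lemma Inv_trapping_region:
  assumes "trapping_region L \<V> N"
  shows "Inv L \<V> N = {x \<in> N. Sol L \<V> (star L \<V> x) N \<noteq> {}}"
  using assms by (simp add: Inv_def trapping_region_def compatible_core_eq)

text \<open>Inside \<open>N\<close>, membership depends on a point only through its star, which is
  constant on each multivector.\<close>

lemma Inv_trapping_region_compatible:
  assumes "trapping_region L \<V> N"
  shows "compatible \<V> (Inv L \<V> N)"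
proof -
  have N: "N \<subseteq> cells L" "compatible \<V> N"
    using assms by (auto simp: trapping_region_def)
  have "y \<in> Inv L \<V> N" if "x \<in> Inv L \<V> N" "y \<in> mv_of \<V> x" for x y
    using that N star_eq[of x y] unfolding Inv_trapping_region[OF assms] compatible_def by auto
  then show ?thesis by (auto simp: compatible_def)
qed

lemma Inv_trapping_region_invariant:
  assumes N: "trapping_region L \<V> N"
  shows "invariant L \<V> (Inv L \<V> N)"
proof -
  note Inv = Inv_trapping_region[OF N]
  have NX: "N \<subseteq> cells L"
    using N by (simp add: trapping_region_def)
  \<comment> \<open>A solution in \<open>N\<close> witnesses that each of its own values is in
    \<open>Inv L \<V> N\<close>: the star of \<open>\<phi> i\<close> is \<open>\<phi> i\<close> or,
    being forced, \<open>\<phi> (i + 1)\<close>.\<close>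
  have "\<phi> i \<in> Inv L \<V> N" if "\<phi> \<in> Sol L \<V> x N" for \<phi> i x
  proof -
    have \<phi>: "full_solution L \<V> \<phi>" "range \<phi> \<subseteq> N"
      using that by (auto simp: Sol_def)
    then have i: "\<phi> i \<in> N" "\<phi> i \<in> cells L" "\<phi> (i + 1) \<in> Pi_mv L \<V> (\<phi> i)"
      using NX by (auto simp: full_solution_iff)
    then have "star L \<V> (\<phi> i) \<in> range \<phi>"
      using Pi_mv_eq_star[OF i(2)] by (metis rangeI singletonD)
    then show ?thesis
      using \<phi> i(1) unfolding Inv Sol_def by blast
  qed
  then have "Sol L \<V> x N \<subseteq> Sol L \<V> x (Inv L \<V> N)" for x
    by (force simp: Sol_def)
  then have "x \<in> Inv L \<V> (Inv L \<V> N)" if "x \<in> Inv L \<V> N" for x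
    using that compatible_core_eq[OF Inv_trapping_region_compatible[OF N]]
    by (subst Inv_def) (auto simp: Inv)
  moreover have "Inv L \<V> (Inv L \<V> N) \<subseteq> Inv L \<V> N"
    by (auto simp: Inv_def)
  moreover have "Inv L \<V> N \<subseteq> cells L"
    using NX by (auto simp: Inv)
  ultimately show ?thesis
    unfolding invariant_def by blast
qed

lemma Inv_trapping_region_closed:
  assumes X: "invariant L \<V> (cells L)" and N: "trapping_region L \<V> N"
  shows "lef_closed L (Inv L \<V> N)"
proof -
  note Inv = Inv_trapping_region[OF N]
  have NX: "N \<subseteq> cells L"
    using N by (simp add: trapping_region_def)
  have "y \<in> Inv L \<V> N" if x: "x \<in> Inv L \<V> N" and yx: "(y, x) \<in> face_order L" for x y
  proof (cases "y \<in> mv_of \<V> x")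
    case True
    then show ?thesis
      using x Inv_trapping_region_compatible[OF N] by (auto simp: compatible_def)
  next
    case False
    have xN: "x \<in> N"
      using x by (simp add: Inv)
    have cells: "x \<in> cells L" "y \<in> cells L"
      using face_order_cells[OF yx] by auto
    have yN: "y \<in> N"
      using trapping_region_closed[OF N] xN yx NX by (auto simp: lef_closed_iff)
    obtain \<phi> a where \<phi>: "full_solution L \<V> \<phi>" "range \<phi> \<subseteq> N" and a: "\<phi> a = star L \<V> x"
      using x by (auto simp: Inv Sol_def)
    have "y \<in> Inv L \<V> (cells L)"
      using X cells by (simp add: invariant_def)
    \<comment> \<open>\<open>\<rho>\<close> comes from the invariance of the whole complex, so it
      need not lie in \<open>N\<close>.\<close>
    then obtain \<rho> b where \<rho>: "full_solution L \<V> \<rho>" and b: "\<rho> b = star L \<V> y"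
      by (auto simp: Inv_def Sol_def)
    have y: "y \<in> Pi_mv L \<V> (\<phi> a)"
      unfolding a using Pi_mv_star[OF cells(1) yx False] .
    have "Sol L \<V> (\<rho> b) N \<noteq> {}"
    proof (cases "y = star L \<V> y")
      case True
      show ?thesis
        by (rule Sol_glue[OF N _ _ \<rho>, of a \<phi>]) (use \<phi> y b True in \<open>auto simp: full_solution_iff\<close>)
    next
      case False
      \<comment> \<open>\<open>y\<close> is not its own star, so it is inserted at time
        \<open>a + 1\<close> as an intermediate step from the star of \<open>x\<close> to that of
        \<open>y\<close>.\<close>
      define \<phi>' where "\<phi>' = \<phi>(a + 1 := y)"
      show ?thesis
      proof (rule Sol_glue[OF N _ _ \<rho>, of "a + 1" \<phi>'])
        show "\<rho> b \<in> Pi_mv L \<V> (\<phi>' (a + 1))"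
          using b False Pi_mv_eq_star[OF cells(2)] by (simp add: \<phi>'_def)
      qed (use \<phi> y yN in \<open>auto simp: \<phi>'_def full_solution_iff\<close>)
    qed
    then show ?thesis
      using yN b by (simp add: Inv)
  qed
  moreover have "Inv L \<V> N \<subseteq> cells L"
    using NX by (auto simp: Inv)
  ultimately show ?thesis
    by (simp add: lef_closed_iff)
qed

end

theorem theorem8p1:
  fixes L :: "('a, 'r::{ring,monoid_mult}) lefschetz"
    and \<V> :: "'a set set"
    and A :: "'a set"
  assumes "lefschetz_complex L"
    and "multivector_field L \<V>"
    and "invariant L \<V> (cells L)"
    and "A \<subseteq> cells L"
  shows "(attractor L \<V> A \<longleftrightarrow> invariant L \<V> A \<and> lef_closed L A) \<and>
         (invariant L \<V> A \<and> lef_closed L A \<longleftrightarrow> isolated_invariant L \<V> A \<and> lef_closed L A) \<and>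
         (isolated_invariant L \<V> A \<and> lef_closed L A \<longleftrightarrow>
            isolated_invariant L \<V> A \<and> lef_closed L A \<and> trapping_region L \<V> A)"
proof -
  interpret mv_field L \<V>
    using assms(1,2) by unfold_locales
  have "invariant L \<V> A \<and> lef_closed L A" if "attractor L \<V> A"
    using that Inv_trapping_region_invariant Inv_trapping_region_closed[OF assms(3)]
    by (auto simp: attractor_def)
  \<comment> \<open>\<open>A\<close> serves as its own trapping region, since
    \<open>A = Inv L \<V> A\<close>.\<close>
  moreover have "attractor L \<V> A" if "trapping_region L \<V> A" "invariant L \<V> A"
    using that by (auto simp: attractor_def invariant_def)
  moreover have "invariant L \<V> A" if "isolated_invariant L \<V> A"
    using that by (simp add: isolated_invariant_def)
  ultimately show ?thesis
    using closed_invariant_isolated invariant_closed_imp_trapping by blast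
qed

end
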